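(* For any graph $G$ and any positive integers $n$ and $t$, $\pi_t^*(G\Box K_n)\le \pi^*_{2t}(G)$. Furthermore, equality holds when $2n\ge \pi^*_{2t}(G)+1$.
   Context: Graphs are finite simple graphs. A distribution on a graph $G=(V,E)$ is a function $D:V\to\mathbb{N}$, with size $|D|=\sum_v D(v)$. A pebbling move removes two pebbles from a vertex having at least two pebbles and places one pebble on a neighbor. A distribution $D$ is $t$-solvable if for every vertex $v$, some sequence of pebbling moves starting from $D$ results in a distribution with at least $t$ pebbles on $v$. The optimal $t$-pebbling number $\pi_t^*(G)$ is the minimum size of a $t$-solvable distribution on $G$. $K_n$ is the complete graph on $n$ vertices and $\Box$ is the Cartesian product of graphs. *)

theory Defs
  imports Graph_Theory.Pair_Digraph Graph_Theory.Kuratowski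
begin

text \<open>
  A finite simple graph is a \<open>pair_graph\<close>: a finite, loop-free, symmetric digraph without
  parallel arcs, in which the edge \<open>uv\<close> is represented by the two arcs \<open>(u, v)\<close> and \<open>(v, u)\<close>.
  Neither connectedness nor a nonempty vertex set is assumed.
\<close>

definition box_prod :: "'a pair_pre_digraph \<Rightarrow> 'b pair_pre_digraph \<Rightarrow> ('a \<times> 'b) pair_pre_digraph"
    (infixl "\<box>" 70) where
  "G \<box> H =
    \<lparr> pverts = pverts G \<times> pverts H,
      parcs = {((u, x), (v, y)) | u x v y.
        (u = v \<and> u \<in> pverts G \<and> (x, y) \<in> parcs H) \<or>
        ((u, v) \<in> parcs G \<and> x = y \<and> x \<in> pverts H)} \<rparr>"

lemma pair_graph_box_prod:
  assumes "pair_graph G" "pair_graph H"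
  shows "pair_graph (G \<box> H)"
proof -
  interpret G: pair_graph G by fact
  interpret H: pair_graph H by fact
  have sub: "parcs (G \<box> H) \<subseteq> pverts (G \<box> H) \<times> pverts (G \<box> H)"
    by (auto simp: box_prod_def dest: G.in_arcsD1 G.in_arcsD2 H.in_arcsD1 H.in_arcsD2)
  have fin: "finite (pverts (G \<box> H))"
    by (simp add: box_prod_def G.pair_finite_verts H.pair_finite_verts)
  have "sym (parcs G)" "sym (parcs H)"
    using G.pair_sym_arcs H.pair_sym_arcs by (simp_all add: symmetric_def)
  then have "sym (parcs (G \<box> H))"
    by (auto simp: box_prod_def intro!: symI dest: symD)
  moreover have "finite (parcs (G \<box> H))"
    using sub fin by (meson finite_SigmaI finite_subset)
  moreover have "fst e \<noteq> snd e" if "e \<in> parcs (G \<box> H)" for e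
    using that by (auto simp: box_prod_def dest: G.no_loops' H.no_loops')
  ultimately show ?thesis
    using sub fin by unfold_locales (auto simp: symmetric_def)
qed

text \<open>
  Functions \<open>V \<rightarrow> \<nat>\<close> are total functions that vanish outside the vertex set.
\<close>

definition distribution :: "'a pair_pre_digraph \<Rightarrow> ('a \<Rightarrow> nat) \<Rightarrow> bool" where
  "distribution G D \<longleftrightarrow> (\<forall>v. v \<notin> pverts G \<longrightarrow> D v = 0)"

definition dist_size :: "'a pair_pre_digraph \<Rightarrow> ('a \<Rightarrow> nat) \<Rightarrow> nat" where
  "dist_size G D = (\<Sum>v\<in>pverts G. D v)"

definition pebbling_move :: "'a pair_pre_digraph \<Rightarrow> ('a \<Rightarrow> nat) \<Rightarrow> ('a \<Rightarrow> nat) \<Rightarrow> bool" where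
  "pebbling_move G D D' \<longleftrightarrow>
    (\<exists>u v. (u, v) \<in> parcs G \<and> 2 \<le> D u \<and> D' = D(u := D u - 2, v := D v + 1))"

definition solvable :: "'a pair_pre_digraph \<Rightarrow> nat \<Rightarrow> ('a \<Rightarrow> nat) \<Rightarrow> bool" where
  "solvable G t D \<longleftrightarrow> (\<forall>v\<in>pverts G. \<exists>D'. (pebbling_move G)\<^sup>*\<^sup>* D D' \<and> t \<le> D' v)"

definition opt_pebbling :: "nat \<Rightarrow> 'a pair_pre_digraph \<Rightarrow> nat" where
  "opt_pebbling t G = (LEAST k. \<exists>D. distribution G D \<and> solvable G t D \<and> dist_size G D = k)"

lemma opt_pebbling_attained:
  "\<exists>D. distribution G D \<and> solvable G t D \<and> dist_size G D = opt_pebbling t G"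
proof -
  let ?D = "\<lambda>v. if v \<in> pverts G then t else 0"
  have "distribution G ?D" by (simp add: distribution_def)
  moreover have "solvable G t ?D"
    unfolding solvable_def by (auto intro!: exI[of _ ?D])
  ultimately have "\<exists>k D. distribution G D \<and> solvable G t D \<and> dist_size G D = k"
    by blast
  then show ?thesis unfolding opt_pebbling_def by (rule LeastI_ex)
qed

end

theory Submission
  imports Defs
begin

text \<open>
  A pebble in a layer \<open>h\<close> of \<open>G \<box> K\<^sub>n\<close> is worth two pebbles of \<open>G\<close>: an optimal distribution
  of \<open>G\<close> placed in one layer reaches \<open>2t\<close> pebbles on \<open>(v, g)\<close> and hence \<open>t\<close> on \<open>(v, h)\<close>.
  Conversely, project a distribution \<open>D\<close> to \<open>G\<close>, giving weight two to the pebbles in some set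
  \<open>S\<close> of layers and weight one to the others; every move upstairs is then dominated by moves
  downstairs, so if \<open>D\<close> is \<open>t\<close>-solvable and \<open>S\<close> contains a layer, the projection is
  \<open>2t\<close>-solvable. If \<open>|D| \<le> 2n - 2\<close>, either some layer is empty and \<open>S\<close> may be taken to be that
  layer without increasing the size, or two layers \<open>g\<close>, \<open>h\<close> carry exactly one pebble each. In
  the latter case delete the pebble of \<open>g\<close> and take \<open>S = {g, h}\<close>, which again preserves the size.
  Deleting it does no harm: it is useless until a second pebble reaches its vertex, and from then
  on dropping the weight of layer \<open>g\<close> from two to one pays for it.
\<close>

section \<open>Pebbling moves along one edge and with one extra pebble\<close>

lemma pebbling_moves_along_arc:
  assumes "(u, v) \<in> parcs G" "u \<noteq> v" "2 * k \<le> D u"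
  shows "(pebbling_move G)\<^sup>*\<^sup>* D (D(u := D u - 2 * k, v := D v + k))"
  using assms(3)
proof (induction k)
  case 0
  then show ?case by simp
next
  case (Suc k)
  let ?E = "D(u := D u - 2 * k, v := D v + k)"
  have "pebbling_move G ?E (D(u := D u - 2 * Suc k, v := D v + Suc k))"
    unfolding pebbling_move_def using assms(1,2) Suc.prems
    by (intro exI[of _ u] exI[of _ v]) (auto simp: fun_eq_iff)
  moreover have "(pebbling_move G)\<^sup>*\<^sup>* D ?E"
    by (rule Suc.IH) (use Suc.prems in simp)
  ultimately show ?case by (rule rtranclp.rtrancl_into_rtrancl[rotated])
qed

definition point :: "'a \<Rightarrow> 'a \<Rightarrow> nat" where
  "point x = (\<lambda>y. if y = x then 1 else 0)"

text \<open>As long as \<open>x\<close> holds nothing but the extra pebble, no move can start at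
  \<open>x\<close>, so every move is also legal without that pebble. Either this lasts to the end
  (\<open>idle\<close>), or some reachable \<open>P1\<close> has a pebble of its own on
  \<open>x\<close> (\<open>used\<close>).\<close>

lemma extra_pebble_cases:
  assumes "(pebbling_move G)\<^sup>*\<^sup>* (\<lambda>y. P y + point x y) P'"
  obtains (idle) P0 where "(pebbling_move G)\<^sup>*\<^sup>* P P0" "P' = (\<lambda>y. P0 y + point x y)"
  | (used) P1 where "(pebbling_move G)\<^sup>*\<^sup>* P P1" "1 \<le> P1 x"
      "(pebbling_move G)\<^sup>*\<^sup>* (\<lambda>y. P1 y + point x y) P'"
proof -
  have "(\<exists>P0. (pebbling_move G)\<^sup>*\<^sup>* P P0 \<and> P' = (\<lambda>y. P0 y + point x y)) \<or>
    (\<exists>P1. (pebbling_move G)\<^sup>*\<^sup>* P P1 \<and> 1 \<le> P1 x \<and>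
      (pebbling_move G)\<^sup>*\<^sup>* (\<lambda>y. P1 y + point x y) P')"
    using assms
  proof (induction rule: rtranclp_induct)
    case base
    then show ?case by blast
  next
    case (step Q Q')
    show ?case
    proof (cases "\<exists>P1. (pebbling_move G)\<^sup>*\<^sup>* P P1 \<and> 1 \<le> P1 x \<and>
        (pebbling_move G)\<^sup>*\<^sup>* (\<lambda>y. P1 y + point x y) Q")
      case True
      with step.hyps(2) show ?thesis by (meson rtranclp.rtrancl_into_rtrancl)
    next
      case False
      with step.IH obtain P0 where P0: "(pebbling_move G)\<^sup>*\<^sup>* P P0"
        and Q: "Q = (\<lambda>y. P0 y + point x y)" by blast
      \<comment> \<open>Otherwise \<open>P0\<close> itself would witness the \<open>used\<close>
        case, with no move left to reach \<open>Q\<close>.\<close>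
      from False P0 Q have "P0 x = 0" by (metis One_nat_def Suc_leI neq0_conv rtranclp.rtrancl_refl)
      from step.hyps(2) obtain u v where uv: "(u, v) \<in> parcs G" "2 \<le> Q u"
        and Q': "Q' = Q(u := Q u - 2, v := Q v + 1)"
        unfolding pebbling_move_def by blast
      from uv(2) Q \<open>P0 x = 0\<close> have "u \<noteq> x" "2 \<le> P0 u" by (auto simp: point_def split: if_splits)
      with uv(1) have "pebbling_move G P0 (P0(u := P0 u - 2, v := P0 v + 1))"
        unfolding pebbling_move_def by blast
      moreover have "Q' = (\<lambda>y. (P0(u := P0 u - 2, v := P0 v + 1)) y + point x y)"
        using \<open>u \<noteq> x\<close> \<open>2 \<le> P0 u\<close> by (auto simp: Q' Q point_def fun_eq_iff)
      ultimately show ?thesis using rtranclp.rtrancl_into_rtrancl[OF P0] by blast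
    qed
  qed
  then show thesis using idle used by blast
qed

section \<open>Weighted projection to the first factor\<close>

definition weight :: "'b set \<Rightarrow> 'b \<Rightarrow> nat" where
  "weight S h = (if h \<in> S then 2 else 1)"

text \<open>The doubled layers \<open>S\<close> are a parameter because \<open>S\<close> shrinks
  from \<open>{g, h}\<close> to \<open>{h}\<close> in the middle of a sequence of moves.\<close>

definition collapse :: "'b set \<Rightarrow> 'b set \<Rightarrow> ('a \<times> 'b \<Rightarrow> nat) \<Rightarrow> 'a \<Rightarrow> nat" where
  "collapse V S P v = (\<Sum>h\<in>V. weight S h * P (v, h))"

text \<open>The old and the new contribution of \<open>(u, h)\<close> are added on opposite sides,
  which avoids truncated subtraction.\<close>

lemma collapse_upd:
  assumes "finite V" "h \<in> V"
  shows "collapse V S (P((u, h) := m)) v + (if v = u then weight S h * P (u, h) else 0)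
    = collapse V S P v + (if v = u then weight S h * m else 0)"
proof -
  have "(\<Sum>g\<in>V - {h}. weight S g * (P((u, h) := m)) (v, g)) = (\<Sum>g\<in>V - {h}. weight S g * P (v, g))"
    by (rule sum.cong) auto
  then show ?thesis
    using assms by (auto simp: collapse_def sum.remove)
qed

text \<open>A move inside a fibre trades two pebbles of weight at least one for one of weight at
  most two, so the projection does not grow. A move along an edge of \<open>G\<close> keeps its
  layer, of weight \<open>w\<close>, and is imitated by \<open>w\<close> moves. Domination by
  \<open>Q\<close> instead of equality lets such steps be chained.\<close>

lemma collapse_move:
  assumes "pair_graph G" "pair_graph H"
    and move: "pebbling_move (G \<box> H) P P'"
    and le: "\<And>v. collapse (pverts H) S P v \<le> Q v"
  shows "\<exists>Q'. (pebbling_move G)\<^sup>*\<^sup>* Q Q' \<and> (\<forall>v. collapse (pverts H) S P' v \<le> Q' v)"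
proof -
  interpret G: pair_graph G by fact
  interpret H: pair_graph H by fact
  let ?C = "collapse (pverts H) S"
  note fin = H.pair_finite_verts
  from move obtain u x v y where arc: "((u, x), (v, y)) \<in> parcs (G \<box> H)" and two: "2 \<le> P (u, x)"
    and P': "P' = P((u, x) := P (u, x) - 2, (v, y) := P (v, y) + 1)"
    unfolding pebbling_move_def by (metis surj_pair)
  have xy: "x \<in> pverts H" "y \<in> pverts H"
    using arc by (auto simp: box_prod_def dest: H.in_arcsD1 H.in_arcsD2)
  have ne: "(u, x) \<noteq> (v, y)"
    using arc by (auto simp: box_prod_def dest: G.no_loops' H.no_loops')
  \<comment> \<open>The state between removing the two pebbles and placing the new one, so that each
    update concerns a single point.\<close>
  define P1 where "P1 = P((u, x) := P (u, x) - 2)"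
  have "P' = P1((v, y) := P1 (v, y) + 1)" using ne by (auto simp: P' P1_def)
  then have gain: "?C P' z = ?C P1 z + (if z = v then weight S y else 0)" for z
    using collapse_upd[OF fin xy(2), of S P1 v "P1 (v, y) + 1" z] by (auto simp: algebra_simps)
  have "weight S x * P (u, x) = weight S x * (P (u, x) - 2) + 2 * weight S x"
    using two by (auto simp: weight_def)
  then have loss: "?C P1 z + (if z = u then 2 * weight S x else 0) = ?C P z" for z
    using collapse_upd[OF fin xy(1), of S P u "P (u, x) - 2" z] by (auto simp: P1_def)
  from arc consider (vertical) "u = v" | (horizontal) "(u, v) \<in> parcs G" "x = y"
    by (auto simp: box_prod_def)
  then show ?thesis
  proof cases
    case vertical
    have "weight S y \<le> 2 * weight S x" by (simp add: weight_def)
    then have "?C P' z \<le> Q z" for z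
      using gain[of z] loss[of z] le[of z] vertical by (auto split: if_splits)
    then show ?thesis by blast
  next
    case horizontal
    define k where "k = weight S x"
    have "u \<noteq> v" using horizontal(1) G.no_loops' by auto
    have "2 * k \<le> Q u" using loss[of u] le[of u] by (simp add: k_def)
    with horizontal(1) \<open>u \<noteq> v\<close>
    have "(pebbling_move G)\<^sup>*\<^sup>* Q (Q(u := Q u - 2 * k, v := Q v + k))"
      by (rule pebbling_moves_along_arc)
    moreover have "?C P' z \<le> (Q(u := Q u - 2 * k, v := Q v + k)) z" for z
      using gain[of z] loss[of z] le[of z] \<open>u \<noteq> v\<close> horizontal(2) by (auto simp: k_def split: if_splits)
    ultimately show ?thesis by blast
  qed
qed

lemma collapse_moves:
  assumes "pair_graph G" "pair_graph H"
    and "(pebbling_move (G \<box> H))\<^sup>*\<^sup>* P P'"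
    and "\<And>v. collapse (pverts H) S P v \<le> Q v"
  shows "\<exists>Q'. (pebbling_move G)\<^sup>*\<^sup>* Q Q' \<and> (\<forall>v. collapse (pverts H) S P' v \<le> Q' v)"
  using assms(3)
proof (induction rule: rtranclp_induct)
  case base
  with assms(4) show ?case by blast
next
  case (step R R')
  then show ?case by (meson collapse_move[OF assms(1,2)] rtranclp_trans)
qed

lemma collapse_ge:
  assumes "finite V" "h \<in> V" "h \<in> S"
  shows "2 * P (v, h) \<le> collapse V S P v"
  using member_le_sum[of h V "\<lambda>h. weight S h * P (v, h)"] assms
  by (simp add: collapse_def weight_def)

section \<open>Sizes of layers and projections\<close>

definition layer_size :: "'a set \<Rightarrow> ('a \<times> 'b \<Rightarrow> nat) \<Rightarrow> 'b \<Rightarrow> nat" where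
  "layer_size U P h = (\<Sum>v\<in>U. P (v, h))"

lemma dist_size_box_prod:
  "dist_size (G \<box> H) P = (\<Sum>h\<in>pverts H. layer_size (pverts G) P h)"
  unfolding dist_size_def layer_size_def box_prod_def
  by (subst sum.swap) (simp add: sum.cartesian_product)

lemma dist_size_collapse:
  assumes "finite (pverts H)" "S \<subseteq> pverts H"
  shows "dist_size G (collapse (pverts H) S P) =
    dist_size (G \<box> H) P + (\<Sum>h\<in>S. layer_size (pverts G) P h)"
proof -
  have "dist_size G (collapse (pverts H) S P) =
      (\<Sum>h\<in>pverts H. weight S h * layer_size (pverts G) P h)"
    unfolding dist_size_def collapse_def layer_size_def
    by (subst sum.swap) (simp add: sum_distrib_left)
  also have "\<dots> = (\<Sum>h\<in>pverts H. layer_size (pverts G) P h +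
      (if h \<in> S then layer_size (pverts G) P h else 0))"
    by (rule sum.cong) (auto simp: weight_def)
  also have "\<dots> = dist_size (G \<box> H) P + (\<Sum>h\<in>S. layer_size (pverts G) P h)"
    using assms by (simp add: sum.distrib dist_size_box_prod sum.If_cases Int_absorb1)
  finally show ?thesis .
qed

lemma distribution_collapse:
  assumes "distribution (G \<box> H) P"
  shows "distribution G (collapse V S P)"
  using assms by (auto simp: distribution_def collapse_def box_prod_def)

section \<open>Solvability of projections\<close>

lemma solvable_collapse_singleton:
  assumes "pair_graph G" "pair_graph H" "h \<in> pverts H" "solvable (G \<box> H) t D"
  shows "solvable G (2 * t) (collapse (pverts H) {h} D)"
  unfolding solvable_def
proof
  interpret H: pair_graph H by fact
  fix v assume "v \<in> pverts G"
  with assms(3,4) obtain D' where D': "(pebbling_move (G \<box> H))\<^sup>*\<^sup>* D D'" "t \<le> D' (v, h)"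
    unfolding solvable_def by (force simp: box_prod_def)
  from collapse_moves[OF assms(1,2) D'(1) order_refl] obtain Q where
    "(pebbling_move G)\<^sup>*\<^sup>* (collapse (pverts H) {h} D) Q"
    "\<forall>v. collapse (pverts H) {h} D' v \<le> Q v" by blast
  moreover have "2 * t \<le> collapse (pverts H) {h} D' v"
    using collapse_ge[OF H.pair_finite_verts assms(3), of "{h}" D' v] D'(2) by simp
  ultimately show "\<exists>D'. (pebbling_move G)\<^sup>*\<^sup>* (collapse (pverts H) {h} D) D' \<and> 2 * t \<le> D' v"
    using order_trans by blast
qed

text \<open>The projection ignores the extra pebble on \<open>(u, g)\<close>, and the targets lie in
  layer \<open>h\<close>. An idle extra pebble stays in layer \<open>g\<close> and contributes
  nothing to them. If it is used, project with doubled layers \<open>{g, h}\<close> up to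
  \<open>P1\<close> and with \<open>{h}\<close> alone afterwards.\<close>

lemma solvable_collapse_extra_pebble:
  assumes "pair_graph G" "pair_graph H" "g \<in> pverts H" "h \<in> pverts H" "g \<noteq> h"
    and "solvable (G \<box> H) t (\<lambda>p. P p + point (u, g) p)"
  shows "solvable G (2 * t) (collapse (pverts H) {g, h} P)"
  unfolding solvable_def
proof
  interpret H: pair_graph H by fact
  let ?C = "collapse (pverts H)"
  note fin = H.pair_finite_verts
  fix v assume "v \<in> pverts G"
  with assms(4,6) obtain D' where D': "(pebbling_move (G \<box> H))\<^sup>*\<^sup>* (\<lambda>p. P p + point (u, g) p) D'"
    and t: "t \<le> D' (v, h)"
    unfolding solvable_def by (force simp: box_prod_def)
  from D' have "\<exists>Q. (pebbling_move G)\<^sup>*\<^sup>* (?C {g, h} P) Q \<and> 2 * t \<le> Q v"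
  proof (cases rule: extra_pebble_cases)
    case (idle P0)
    from collapse_moves[OF assms(1,2) idle(1) order_refl] obtain Q where
      Q: "(pebbling_move G)\<^sup>*\<^sup>* (?C {g, h} P) Q" "\<forall>v. ?C {g, h} P0 v \<le> Q v" by blast
    have "P0 (v, h) = D' (v, h)" using idle(2) assms(5) by (simp add: point_def)
    then have "2 * t \<le> ?C {g, h} P0 v"
      using collapse_ge[OF fin assms(4), of "{g, h}" P0 v] t by simp
    with Q show ?thesis using order_trans by blast
  next
    case (used P1)
    from collapse_moves[OF assms(1,2) used(1) order_refl] obtain Q where
      Q: "(pebbling_move G)\<^sup>*\<^sup>* (?C {g, h} P) Q" "\<forall>v. ?C {g, h} P1 v \<le> Q v" by blast
    \<comment> \<open>At \<open>(u, g)\<close> this is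
      \<open>P1 (u, g) + 1 \<le> 2 * P1 (u, g)\<close>; at all other points weights can only
      drop.\<close>
    have "?C {h} (\<lambda>p. P1 p + point (u, g) p) z \<le> ?C {g, h} P1 z" for z
      unfolding collapse_def
      using used(2) assms(5) by (intro sum_mono) (auto simp: weight_def point_def)
    with Q(2) have "?C {h} (\<lambda>p. P1 p + point (u, g) p) z \<le> Q z" for z
      using order_trans by blast
    from collapse_moves[OF assms(1,2) used(3) this] obtain Q' where
      Q': "(pebbling_move G)\<^sup>*\<^sup>* Q Q'" "\<forall>v. ?C {h} D' v \<le> Q' v" by blast
    have "2 * t \<le> ?C {h} D' v"
      using collapse_ge[OF fin assms(4), of "{h}" D' v] t by simp
    with Q' Q(1) show ?thesis by (meson order_trans rtranclp_trans)
  qed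
  then show "\<exists>D'. (pebbling_move G)\<^sup>*\<^sup>* (?C {g, h} P) D' \<and> 2 * t \<le> D' v" .
qed

section \<open>Lower bound from sparse distributions\<close>

text \<open>If no value is zero, every value reaches two once the ones are raised by one. Summing,
  there are at least \<open>2 * card V - sum f V\<close>, hence two, ones.\<close>

lemma sparse_family_cases:
  fixes f :: "'a \<Rightarrow> nat"
  assumes "finite V" "sum f V + 2 \<le> 2 * card V"
  obtains h where "h \<in> V" "f h = 0"
  | g h where "g \<in> V" "h \<in> V" "g \<noteq> h" "f g = 1" "f h = 1"
proof (cases "\<exists>h\<in>V. f h = 0")
  case True
  then show ?thesis using that by blast
next
  case False
  let ?A = "{h \<in> V. f h = 1}"
  have "(\<Sum>h\<in>V. 2) \<le> (\<Sum>h\<in>V. f h + (if f h = 1 then 1 else 0))"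
    using False by (intro sum_mono) (auto simp: not_less_eq_eq Suc_le_eq)
  also have "\<dots> = sum f V + card ?A"
    using assms(1) by (simp add: sum.distrib sum.If_cases Int_def)
  finally have "2 \<le> card ?A" using assms(2) by simp
  then obtain B where "B \<subseteq> ?A" "card B = 2" by (meson obtain_subset_with_card_n)
  then show ?thesis using that(2) by (auto simp: card_2_iff)
qed

lemma opt_pebbling_le:
  assumes "distribution G D" "solvable G t D"
  shows "opt_pebbling t G \<le> dist_size G D"
  unfolding opt_pebbling_def using assms by (intro Least_le) blast

lemma opt_pebbling_le_of_sparse:
  assumes "pair_graph G" "pair_graph H"
    and D: "distribution (G \<box> H) D" "solvable (G \<box> H) t D"
    and sparse: "dist_size (G \<box> H) D + 2 \<le> 2 * card (pverts H)"
  shows "opt_pebbling (2 * t) G \<le> dist_size (G \<box> H) D"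
proof -
  interpret G: pair_graph G by fact
  interpret H: pair_graph H by fact
  note fin = H.pair_finite_verts
  let ?L = "layer_size (pverts G)"
  let ?C = "collapse (pverts H)"
  from sparse have "sum (?L D) (pverts H) + 2 \<le> 2 * card (pverts H)"
    by (simp add: dist_size_box_prod)
  with fin show ?thesis
  proof (cases rule: sparse_family_cases)
    case (1 h)
    then have "dist_size G (?C {h} D) = dist_size (G \<box> H) D"
      using dist_size_collapse[OF fin, of "{h}" G D] by simp
    then show ?thesis
      using opt_pebbling_le[OF distribution_collapse[OF D(1)]
          solvable_collapse_singleton[OF assms(1,2) 1(1) D(2)]] by simp
  next
    case (2 g h)
    from 2(4) obtain u where u: "u \<in> pverts G" "D (u, g) \<noteq> 0"
      unfolding layer_size_def by (metis sum.neutral zero_neq_one)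
    define P where "P = D((u, g) := D (u, g) - 1)"
    have DP: "D = (\<lambda>p. P p + point (u, g) p)"
      using u(2) by (auto simp: P_def point_def fun_eq_iff)
    have dP: "distribution (G \<box> H) P"
      using D(1) by (auto simp: distribution_def P_def)
    have LD: "?L D k = ?L P k + (if k = g then 1 else 0)" for k
      unfolding layer_size_def DP using u(1) G.pair_finite_verts
      by (auto simp: sum.distrib point_def)
    have "dist_size (G \<box> H) D = dist_size (G \<box> H) P + 1"
      unfolding dist_size_box_prod using 2(1) fin by (simp add: LD sum.distrib)
    \<comment> \<open>In \<open>P\<close> layer \<open>g\<close> is empty and layer \<open>h\<close>
      has one pebble, so doubling both adds exactly the pebble that was deleted.\<close>
    moreover have "dist_size G (?C {g, h} P) = dist_size (G \<box> H) P + 1"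
      using dist_size_collapse[OF fin, of "{g, h}" G P] 2 LD[of g] LD[of h] by simp
    ultimately show ?thesis
      using opt_pebbling_le[OF distribution_collapse[OF dP]
          solvable_collapse_extra_pebble[OF assms(1,2) 2(1,2,3) D(2)[unfolded DP]]] by simp
  qed
qed

section \<open>Upper bound by filling a single layer\<close>

definition in_layer :: "'b \<Rightarrow> ('a \<Rightarrow> nat) \<Rightarrow> 'a \<times> 'b \<Rightarrow> nat" where
  "in_layer g D = (\<lambda>(v, h). if h = g then D v else 0)"

lemma pebbling_moves_layer:
  assumes "(pebbling_move G)\<^sup>*\<^sup>* D D'" "g \<in> pverts H"
  shows "(pebbling_move (G \<box> H))\<^sup>*\<^sup>* (in_layer g D) (in_layer g D')"
  using assms(1)
proof (induction rule: rtranclp_induct)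
  case base
  show ?case by simp
next
  case (step E E')
  from step.hyps(2) obtain u v where uv: "(u, v) \<in> parcs G" "2 \<le> E u"
    "E' = E(u := E u - 2, v := E v + 1)"
    unfolding pebbling_move_def by blast
  have "pebbling_move (G \<box> H) (in_layer g E) (in_layer g E')"
    unfolding pebbling_move_def
  proof (intro exI conjI)
    show "((u, g), (v, g)) \<in> parcs (G \<box> H)" using uv(1) assms(2) by (simp add: box_prod_def)
    show "2 \<le> in_layer g E (u, g)" using uv(2) by (simp add: in_layer_def)
    show "in_layer g E' = (in_layer g E)((u, g) := in_layer g E (u, g) - 2, (v, g) := in_layer g E (v, g) + 1)"
      by (auto simp: in_layer_def uv(3) fun_eq_iff)
  qed
  then show ?case by (rule rtranclp.rtrancl_into_rtrancl[OF step.IH])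
qed

lemma opt_pebbling_box_prod_complete_le:
  assumes "finite (pverts H)" "g \<in> pverts H"
    and complete: "\<And>h. h \<in> pverts H \<Longrightarrow> h \<noteq> g \<Longrightarrow> (g, h) \<in> parcs H"
  shows "opt_pebbling t (G \<box> H) \<le> opt_pebbling (2 * t) G"
proof -
  obtain D where D: "distribution G D" "solvable G (2 * t) D"
    "dist_size G D = opt_pebbling (2 * t) G"
    using opt_pebbling_attained by blast
  have "distribution (G \<box> H) (in_layer g D)"
    using D(1) by (auto simp: distribution_def box_prod_def in_layer_def assms(2))
  moreover have "solvable (G \<box> H) t (in_layer g D)"
    unfolding solvable_def
  proof
    fix p assume "p \<in> pverts (G \<box> H)"
    then obtain v h where p: "p = (v, h)" and v: "v \<in> pverts G" and h: "h \<in> pverts H"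
      by (auto simp: box_prod_def)
    from D(2) v obtain D' where D': "(pebbling_move G)\<^sup>*\<^sup>* D D'" "2 * t \<le> D' v"
      unfolding solvable_def by blast
    note moves = pebbling_moves_layer[OF D'(1) assms(2)]
    show "\<exists>E. (pebbling_move (G \<box> H))\<^sup>*\<^sup>* (in_layer g D) E \<and> t \<le> E p"
    proof (cases "h = g")
      case True
      then show ?thesis using moves D'(2) p by (intro exI[of _ "in_layer g D'"]) (simp add: in_layer_def)
    next
      case False
      with h v complete have "((v, g), (v, h)) \<in> parcs (G \<box> H)" by (auto simp: box_prod_def)
      \<comment> \<open>Making \<open>t\<close> moves across the fibre leaves exactly
        \<open>t\<close> pebbles on \<open>(v, h)\<close>, since layer \<open>h\<close> was
        empty.\<close>
      from pebbling_moves_along_arc[OF this, of t "in_layer g D'"] False D'(2)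
      have "(pebbling_move (G \<box> H))\<^sup>*\<^sup>* (in_layer g D')
        ((in_layer g D')((v, g) := D' v - 2 * t, (v, h) := t))" by (simp add: in_layer_def)
      with moves have "(pebbling_move (G \<box> H))\<^sup>*\<^sup>* (in_layer g D)
        ((in_layer g D')((v, g) := D' v - 2 * t, (v, h) := t))" by (rule rtranclp_trans)
      then show ?thesis using p by (intro exI) (rule conjI, assumption, simp)
    qed
  qed
  moreover have "dist_size (G \<box> H) (in_layer g D) = dist_size G D"
    unfolding dist_size_box_prod using assms(1,2)
    by (simp add: layer_size_def dist_size_def in_layer_def if_distrib[of "\<lambda>x. sum x _"] cong: if_cong)
      (simp add: sum.remove[of _ g])
  ultimately show ?thesis using opt_pebbling_le D(3) by metis
qed

theorem theorem3p8:
  fixes G :: "'a pair_pre_digraph" and H :: "'b pair_pre_digraph" and n t :: nat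
  assumes "pair_graph G"
    and "n > 0" and "t > 0"
    and "complete_digraph n (with_proj H)"
  shows "opt_pebbling t (G \<box> H) \<le> opt_pebbling (2 * t) G \<and>
    (2 * n \<ge> opt_pebbling (2 * t) G + 1 \<longrightarrow>
      opt_pebbling t (G \<box> H) = opt_pebbling (2 * t) G)"
proof -
  have pH: "pair_graph H" using assms(4) by (rule pair_graphI_complete)
  have fin: "finite (pverts H)" and card: "card (pverts H) = n"
    and arcs: "parcs H = {(u, v). (u, v) \<in> pverts H \<times> pverts H \<and> u \<noteq> v}"
    using assms(4) by (auto simp: complete_digraph_pair_def)
  then obtain g where g: "g \<in> pverts H" using assms(2) by fastforce
  have le: "opt_pebbling t (G \<box> H) \<le> opt_pebbling (2 * t) G"
    using g by (intro opt_pebbling_box_prod_complete_le[OF fin g]) (simp add: arcs)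
  moreover have "opt_pebbling (2 * t) G \<le> opt_pebbling t (G \<box> H)"
    if "2 * n \<ge> opt_pebbling (2 * t) G + 1"
  proof (rule ccontr)
    assume less: "\<not> ?thesis"
    obtain D where D: "distribution (G \<box> H) D" "solvable (G \<box> H) t D"
      "dist_size (G \<box> H) D = opt_pebbling t (G \<box> H)"
      using opt_pebbling_attained by blast
    \<comment> \<open>Arguing by contradiction gains the missing unit: strict inequality gives
      \<open>dist_size (G \<box> H) D + 1 \<le> opt_pebbling (2 * t) G\<close>, and the right side
      is at most \<open>2 * n - 1\<close>.\<close>
    from less that D(3) have "dist_size (G \<box> H) D + 2 \<le> 2 * card (pverts H)"
      by (simp add: card)
    from opt_pebbling_le_of_sparse[OF assms(1) pH D(1,2) this] D(3) less show False by simp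
  qed
  ultimately show ?thesis by (simp add: le_antisym)
qed

end
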